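(* Let $(M,g)$ be a four-dimensional Lorentzian manifold, $A$ a $1$-form on $M$, $x\in M$, and $y\in T_xM$ with $|g(y,y)|^{1/2}\neq0$. Then $$\mathrm{Tr}(\mathcal{M}\cdot\mathcal{F}_A)=4\left(\mp|g(y,y)|^{1/2}+A_jy^j\right),$$ where the negative sign corresponds to the case $g(y,y)<0$ and the positive sign corresponds to the case $g(y,y)>0$.
   Context: Fix a $g$-orthonormal frame of $T_xM$; the components of $g_x$ in it are $\eta_{ij}$, diagonal, with one entry $-1$ and three entries $+1$. Components of $y\in T_xM$ in this frame are $y^i$, components of $A$ at $x$ are $A_i$, $i=1,\dots,4$, and repeated indices are summed; thus $g(y,y)=\eta(y,y):=\eta_{ij}y^iy^j$. Let $\gamma_1,\dots,\gamma_4$ be $4\times4$ complex (Dirac) matrices with $\gamma_i\gamma_j+\gamma_j\gamma_i=2\eta_{ij}\mathbb{I}_4$, where $\mathbb{I}_4$ is the $4\times4$ identity matrix, and let $\mathrm{Tr}$ be the usual matrix trace (so $\mathrm{Tr}(\gamma_i)=0$ and $\mathrm{Tr}(\gamma_i\gamma_j)=4\eta_{ij}$). For $\eta(y,y)\neq0$ define $$\mathcal{M}=\frac{\gamma_iy^i}{|\eta(y,y)|^{1/2}}-\mathbb{I}_4,\qquad \mathcal{F}_A=\gamma_iy^i-A_iy^i\,\mathbb{I}_4.$$ *)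

theory Defs
  imports "HOL-Analysis.Analysis" "HOL-Library.Function_Algebras"
begin

text \<open>Pointwise scalar multiplication, so that tangent vectors (functionals on smooth functions)
  live in a real vector space and the library notions of span, independence and coordinates apply.\<close>

instantiation "fun" :: (type, real_vector) real_vector
begin

definition scaleR_fun_def: "scaleR c f = (\<lambda>x. c *\<^sub>R f x)"

instance
  by standard (simp_all add: scaleR_fun_def fun_eq_iff scaleR_add_right scaleR_add_left)

end

subsection \<open>Smooth manifolds\<close>

text \<open>Only meaningful for open \<open>S\<close>: the derivative is the unrestricted Frechet derivative.\<close>

fun Ck_on :: "nat \<Rightarrow> 'a::real_normed_vector set \<Rightarrow> ('a \<Rightarrow> 'b::real_normed_vector) \<Rightarrow> bool" where
  "Ck_on 0 S f \<longleftrightarrow> continuous_on S f"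
| "Ck_on (Suc k) S f \<longleftrightarrow>
     (\<forall>u\<in>S. f differentiable (at u)) \<and> (\<forall>v. Ck_on k S (\<lambda>u. frechet_derivative f (at u) v))"

definition smooth_on :: "'a::real_normed_vector set \<Rightarrow> ('a \<Rightarrow> 'b::real_normed_vector) \<Rightarrow> bool" where
  "smooth_on S f \<longleftrightarrow> (\<forall>k. Ck_on k S f)"

text \<open>The manifold is a whole type \<open>'m\<close> with its topology; its dimension is \<open>CARD('n)\<close>.
  A chart is a pair of a domain and a coordinate map, the latter being irrelevant off the domain.\<close>

type_synonym ('m, 'n) chart = "'m set \<times> ('m \<Rightarrow> real^'n)"

definition chart :: "('m::topological_space, 'n::finite) chart \<Rightarrow> bool" where
  "chart = (\<lambda>(U, \<phi>). open U \<and> open (\<phi> ` U) \<and> homeomorphism U (\<phi> ` U) \<phi> (inv_into U \<phi>))"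

definition smooth_atlas ::
  "('m::{t2_space, second_countable_topology}, 'n::finite) chart set \<Rightarrow> bool" where
  "smooth_atlas \<A> \<longleftrightarrow>
     (\<forall>c\<in>\<A>. chart c) \<and>
     (\<Union>c\<in>\<A>. fst c) = UNIV \<and>
     (\<forall>(U, \<phi>)\<in>\<A>. \<forall>(V, \<psi>)\<in>\<A>. smooth_on (\<phi> ` (U \<inter> V)) (\<psi> \<circ> inv_into U \<phi>))"

definition smooth_functions ::
  "('m::topological_space, 'n::finite) chart set \<Rightarrow> ('m \<Rightarrow> real) set" where
  "smooth_functions \<A> = {f. \<forall>(U, \<phi>)\<in>\<A>. smooth_on (\<phi> ` U) (f \<circ> inv_into U \<phi>)}"

text \<open>The tangent space at \<open>p\<close> consists of the derivations at \<open>p\<close> of the algebra of smooth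
  functions. Since HOL functions are total, a derivation is normalised to be \<open>0\<close> on non-smooth
  functions, so that equality of derivations is equality of HOL functions.\<close>

type_synonym 'm tangent_vector = "('m \<Rightarrow> real) \<Rightarrow> real"

definition tangent_space ::
  "('m::topological_space, 'n::finite) chart set \<Rightarrow> 'm \<Rightarrow> 'm tangent_vector set" where
  "tangent_space \<A> p = {v.
     (\<forall>f\<in>smooth_functions \<A>. \<forall>h\<in>smooth_functions \<A>.
        v (\<lambda>q. f q + h q) = v f + v h \<and>
        v (\<lambda>q. f q * h q) = f p * v h + h p * v f) \<and>
     (\<forall>f\<in>smooth_functions \<A>. \<forall>c. v (\<lambda>q. c * f q) = c * v f) \<and>
     (\<forall>f. f \<notin> smooth_functions \<A> \<longrightarrow> v f = 0)}"

definition coordinate_vector ::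
  "('m::topological_space, 'n::finite) chart set \<Rightarrow> ('m, 'n) chart \<Rightarrow> 'm \<Rightarrow> 'n \<Rightarrow> 'm tangent_vector"
  where
  "coordinate_vector \<A> = (\<lambda>(U, \<phi>) p i f.
     if f \<in> smooth_functions \<A>
     then frechet_derivative (f \<circ> inv_into U \<phi>) (at (\<phi> p)) (axis i 1)
     else 0)"

subsection \<open>One-forms, frames and Lorentzian metrics\<close>

text \<open>The values of forms and metrics at arguments outside the tangent spaces are irrelevant.\<close>

definition linear_form_on :: "'v::real_vector set \<Rightarrow> ('v \<Rightarrow> real) \<Rightarrow> bool" where
  "linear_form_on T \<alpha> \<longleftrightarrow>
     (\<forall>v\<in>T. \<forall>w\<in>T. \<alpha> (v + w) = \<alpha> v + \<alpha> w) \<and> (\<forall>v\<in>T. \<forall>c. \<alpha> (c *\<^sub>R v) = c * \<alpha> v)"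

definition one_form ::
  "('m::topological_space, 'n::finite) chart set \<Rightarrow> ('m \<Rightarrow> 'm tangent_vector \<Rightarrow> real) \<Rightarrow> bool" where
  "one_form \<A> A \<longleftrightarrow>
     (\<forall>p. linear_form_on (tangent_space \<A> p) (A p)) \<and>
     (\<forall>(U, \<phi>)\<in>\<A>. \<forall>i. smooth_on (\<phi> ` U)
        (\<lambda>u. let p = inv_into U \<phi> u in A p (coordinate_vector \<A> (U, \<phi>) p i)))"

definition frame ::
  "('m::topological_space, 'n::finite) chart set \<Rightarrow> 'm \<Rightarrow> ('n \<Rightarrow> 'm tangent_vector) \<Rightarrow> bool" where
  "frame \<A> p E \<longleftrightarrow> inj E \<and> independent (range E) \<and> span (range E) = tangent_space \<A> p"

text \<open>Diagonal, with one entry \<open>-1\<close> (at an unspecified position) and all others \<open>+1\<close>.\<close>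

definition lorentz_diagonal :: "('n::finite \<Rightarrow> 'n \<Rightarrow> real) \<Rightarrow> bool" where
  "lorentz_diagonal \<eta> \<longleftrightarrow>
     (\<exists>k. \<forall>i j. \<eta> i j = (if i \<noteq> j then 0 else if i = k then -1 else 1))"

definition frame_metric ::
  "('m \<Rightarrow> 'm tangent_vector \<Rightarrow> 'm tangent_vector \<Rightarrow> real) \<Rightarrow> 'm \<Rightarrow>
   ('n \<Rightarrow> 'm tangent_vector) \<Rightarrow> 'n \<Rightarrow> 'n \<Rightarrow> real" where
  "frame_metric g p E i j = g p (E i) (E j)"

definition orthonormal_frame ::
  "('m::topological_space, 'n::finite) chart set \<Rightarrow>
   ('m \<Rightarrow> 'm tangent_vector \<Rightarrow> 'm tangent_vector \<Rightarrow> real) \<Rightarrow> 'm \<Rightarrow>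
   ('n \<Rightarrow> 'm tangent_vector) \<Rightarrow> bool" where
  "orthonormal_frame \<A> g p E \<longleftrightarrow> frame \<A> p E \<and> lorentz_diagonal (frame_metric g p E)"

definition lorentzian_metric ::
  "('m::topological_space, 'n::finite) chart set \<Rightarrow>
   ('m \<Rightarrow> 'm tangent_vector \<Rightarrow> 'm tangent_vector \<Rightarrow> real) \<Rightarrow> bool" where
  "lorentzian_metric \<A> g \<longleftrightarrow>
     (\<forall>p. \<forall>v\<in>tangent_space \<A> p. linear_form_on (tangent_space \<A> p) (g p v)) \<and>
     (\<forall>p. \<forall>v\<in>tangent_space \<A> p. \<forall>w\<in>tangent_space \<A> p. g p v w = g p w v) \<and>
     (\<forall>p. \<exists>E. orthonormal_frame \<A> g p E) \<and>
     (\<forall>(U, \<phi>)\<in>\<A>. \<forall>i j. smooth_on (\<phi> ` U)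
        (\<lambda>u. let p = inv_into U \<phi> u in
           g p (coordinate_vector \<A> (U, \<phi>) p i) (coordinate_vector \<A> (U, \<phi>) p j)))"

definition lorentzian_manifold ::
  "('m::{t2_space, second_countable_topology}, 'n::finite) chart set \<Rightarrow>
   ('m \<Rightarrow> 'm tangent_vector \<Rightarrow> 'm tangent_vector \<Rightarrow> real) \<Rightarrow> bool" where
  "lorentzian_manifold \<A> g \<longleftrightarrow> smooth_atlas \<A> \<and> lorentzian_metric \<A> g"

definition frame_components ::
  "('n \<Rightarrow> 'm tangent_vector) \<Rightarrow> 'm tangent_vector \<Rightarrow> 'n \<Rightarrow> real" where
  "frame_components E y i = representation (range E) y (E i)"

subsection \<open>Dirac matrices\<close>

definition dirac_matrices :: "(4 \<Rightarrow> 4 \<Rightarrow> real) \<Rightarrow> (4 \<Rightarrow> complex^4^4) \<Rightarrow> bool" where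
  "dirac_matrices \<eta> \<gamma> \<longleftrightarrow>
     (\<forall>i j. \<gamma> i ** \<gamma> j + \<gamma> j ** \<gamma> i = (2 * \<eta> i j) *\<^sub>R mat 1)"

text \<open>In the next two definitions \<open>y\<close> and \<open>A\<close> are families of components in a fixed frame.
  Multiplication of matrices by real scalars is \<open>scaleR\<close>.\<close>

definition dirac_M :: "(4 \<Rightarrow> 4 \<Rightarrow> real) \<Rightarrow> (4 \<Rightarrow> complex^4^4) \<Rightarrow> (4 \<Rightarrow> real) \<Rightarrow> complex^4^4" where
  "dirac_M \<eta> \<gamma> y =
     (\<Sum>i\<in>UNIV. y i *\<^sub>R \<gamma> i) /\<^sub>R sqrt \<bar>\<Sum>i\<in>UNIV. \<Sum>j\<in>UNIV. \<eta> i j * y i * y j\<bar> - mat 1"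

definition dirac_F :: "(4 \<Rightarrow> complex^4^4) \<Rightarrow> (4 \<Rightarrow> real) \<Rightarrow> (4 \<Rightarrow> real) \<Rightarrow> complex^4^4" where
  "dirac_F \<gamma> A y = (\<Sum>i\<in>UNIV. y i *\<^sub>R \<gamma> i) - (\<Sum>i\<in>UNIV. A i * y i) *\<^sub>R mat 1"

end

theory Submission
  imports Defs
begin

text \<open>
  Write \<open>Y = \<Sum>i. y\<^sup>i \<gamma>\<^sub>i\<close>. The Clifford relations say that \<open>Y\<close> is
  a square root of its quadratic form, \<open>Y\<^sup>2 = \<eta>(y,y) \<cdot> 1\<close> (\<open>dirac_slash_square\<close>), and they force
  \<open>Tr Y = 0\<close> (\<open>trace_dirac_slash\<close>), because each \<open>\<gamma>\<^sub>i\<close> anticommutes with an invertible \<open>\<gamma>\<^sub>j\<close>.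
  Therefore, in the expansion of \<open>(Y/s - 1)(Y - a \<cdot> 1)\<close> with \<open>s = \<surd>\<bar>\<eta>(y,y)\<bar>\<close> and
  \<open>a = \<Sum>j. A\<^sub>j y\<^sup>j\<close>, the two terms linear in \<open>Y\<close> have trace zero and the trace is
  \<open>4(\<eta>(y,y)/s + a)\<close>. Since \<open>\<eta>(y,y) = \<plusminus>s\<^sup>2\<close>, the first summand is \<open>\<plusminus>s\<close>, with the sign of \<open>\<eta>(y,y)\<close>.

  At the point \<open>x\<close>, bilinearity of \<open>g\<^sub>x\<close> on the span of the frame gives
  \<open>g\<^sub>x(y,y) = \<eta>(y,y)\<close> (\<open>lorentzian_metric_frame_components\<close>), which identifies the quadratic form
  of the Clifford relations with \<open>g\<^sub>x\<close>.
\<close>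

lemma linear_form_on_sum:
  assumes "linear_form_on T \<alpha>" "subspace T" "finite I" "\<And>i. i \<in> I \<Longrightarrow> e i \<in> T"
  shows "\<alpha> (\<Sum>i\<in>I. c i *\<^sub>R e i) = (\<Sum>i\<in>I. c i * \<alpha> (e i))"
  using assms(3,4)
proof (induction I rule: finite_induct)
  case empty
  have "\<alpha> (0 *\<^sub>R 0) = 0 * \<alpha> 0"
    using assms(1) subspace_0[OF assms(2)] unfolding linear_form_on_def by blast
  then show ?case by simp
next
  case (insert i I)
  have "c i *\<^sub>R e i \<in> T" "(\<Sum>j\<in>I. c j *\<^sub>R e j) \<in> T" "e i \<in> T"
    using insert.prems assms(2) by (auto intro!: subspace_sum subspace_scale)
  then have "\<alpha> (c i *\<^sub>R e i + (\<Sum>j\<in>I. c j *\<^sub>R e j)) = c i * \<alpha> (e i) + \<alpha> (\<Sum>j\<in>I. c j *\<^sub>R e j)"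
    using assms(1) unfolding linear_form_on_def by simp
  then show ?case
    using insert by simp
qed

lemma subspace_tangent_space_of_frame: "frame \<A> p E \<Longrightarrow> subspace (tangent_space \<A> p)"
  unfolding frame_def by (metis subspace_span)

lemma frame_in_tangent_space: "frame \<A> p E \<Longrightarrow> E i \<in> tangent_space \<A> p"
  unfolding frame_def by (metis span_base rangeI)

lemma sum_frame_components:
  assumes "frame \<A> p E" "y \<in> tangent_space \<A> p"
  shows "(\<Sum>i\<in>UNIV. frame_components E y i *\<^sub>R E i) = y"
proof -
  have E: "inj E" "independent (range E)" "y \<in> span (range E)"
    using assms unfolding frame_def by auto
  have "(\<Sum>b\<in>range E. representation (range E) y b *\<^sub>R b) = y"
    by (rule real_vector.sum_representation_eq) (use E in auto)
  then show ?thesis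
    unfolding frame_components_def by (simp add: sum.reindex[OF E(1)] o_def)
qed

lemma linear_form_on_frame_components:
  assumes "frame \<A> p E" "y \<in> tangent_space \<A> p" "linear_form_on (tangent_space \<A> p) \<alpha>"
  shows "\<alpha> y = (\<Sum>i\<in>UNIV. frame_components E y i * \<alpha> (E i))"
proof -
  have "\<alpha> y = \<alpha> (\<Sum>i\<in>UNIV. frame_components E y i *\<^sub>R E i)"
    using sum_frame_components[OF assms(1,2)] by simp
  also have "\<dots> = (\<Sum>i\<in>UNIV. frame_components E y i * \<alpha> (E i))"
    by (intro linear_form_on_sum[OF assms(3)] subspace_tangent_space_of_frame[OF assms(1)]
        frame_in_tangent_space[OF assms(1)]) simp_all
  finally show ?thesis .
qed

lemma lorentzian_metric_frame_components:
  assumes g: "lorentzian_metric \<A> g" and E: "frame \<A> p E" and y: "y \<in> tangent_space \<A> p"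
  shows "g p y y = (\<Sum>i\<in>UNIV. \<Sum>j\<in>UNIV.
           frame_metric g p E i j * frame_components E y i * frame_components E y j)"
proof -
  let ?c = "frame_components E y"
  have lin: "linear_form_on (tangent_space \<A> p) (g p v)" if "v \<in> tangent_space \<A> p" for v
    using g that unfolding lorentzian_metric_def by blast
  have "g p y y = (\<Sum>j\<in>UNIV. ?c j * g p y (E j))"
    by (rule linear_form_on_frame_components[OF E y lin[OF y]])
  \<comment> \<open>Only linearity in the second argument is postulated; linearity in the first comes from symmetry.\<close>
  also have "\<dots> = (\<Sum>j\<in>UNIV. ?c j * g p (E j) y)"
    using g y frame_in_tangent_space[OF E] unfolding lorentzian_metric_def by (metis (no_types))
  also have "\<dots> = (\<Sum>j\<in>UNIV. ?c j * (\<Sum>i\<in>UNIV. ?c i * g p (E j) (E i)))"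
    by (intro sum.cong refl arg_cong2[where f = "(*)"]
        linear_form_on_frame_components[OF E y lin] frame_in_tangent_space[OF E])
  also have "\<dots> = (\<Sum>i\<in>UNIV. \<Sum>j\<in>UNIV. frame_metric g p E i j * ?c i * ?c j)"
    by (simp add: frame_metric_def sum_distrib_left mult_ac)
  finally show ?thesis .
qed

lemma bilinear_matrix_mult:
  "bilinear ((**) :: 'a::real_algebra_1^'n^'m \<Rightarrow> 'a^'k^'n \<Rightarrow> 'a^'k^'m)"
  unfolding bilinear_def
  by (auto intro!: linearI simp: vec_eq_iff matrix_matrix_mult_def sum.distrib
      distrib_left distrib_right scaleR_sum_right)

lemma linear_trace: "linear (trace :: 'a::real_algebra_1^'n^'n \<Rightarrow> 'a)"
  by (rule linearI) (simp_all add: trace_def sum.distrib scaleR_sum_right)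

text \<open>Symmetrising the double sum that expands the square turns every product of two Dirac matrices
  into an anticommutator.\<close>

lemma dirac_slash_square:
  assumes "dirac_matrices \<eta> \<gamma>"
  shows "(\<Sum>i\<in>UNIV. y i *\<^sub>R \<gamma> i) ** (\<Sum>i\<in>UNIV. y i *\<^sub>R \<gamma> i) =
         (\<Sum>i\<in>UNIV. \<Sum>j\<in>UNIV. \<eta> i j * y i * y j) *\<^sub>R mat 1"
proof -
  let ?Y = "\<Sum>i\<in>UNIV. y i *\<^sub>R \<gamma> i"
  have expand: "?Y ** ?Y = (\<Sum>i\<in>UNIV. \<Sum>j\<in>UNIV. (y i * y j) *\<^sub>R (\<gamma> i ** \<gamma> j))"
    by (simp add: bilinear_sum[OF bilinear_matrix_mult] sum.cartesian_product
        bilinear_lmul[OF bilinear_matrix_mult] bilinear_rmul[OF bilinear_matrix_mult] mult.commute)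
  also have "\<dots> = (\<Sum>i\<in>UNIV. \<Sum>j\<in>UNIV. (y i * y j) *\<^sub>R (\<gamma> j ** \<gamma> i))"
    by (subst sum.swap) (simp add: mult.commute)
  finally have "2 *\<^sub>R (?Y ** ?Y) =
      (\<Sum>i\<in>UNIV. \<Sum>j\<in>UNIV. (y i * y j) *\<^sub>R (\<gamma> i ** \<gamma> j + \<gamma> j ** \<gamma> i))"
    using expand by (simp add: scaleR_2 sum.distrib scaleR_add_right)
  also have "\<dots> = 2 *\<^sub>R ((\<Sum>i\<in>UNIV. \<Sum>j\<in>UNIV. \<eta> i j * y i * y j) *\<^sub>R mat 1)"
    using assms unfolding dirac_matrices_def
    by (simp add: scaleR_sum_left scaleR_sum_right mult_ac)
  finally show ?thesis by (simp only: scaleR_cancel_left) simp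
qed

text \<open>For \<open>j \<noteq> i\<close> the matrix \<open>\<gamma>\<^sub>j\<close> anticommutes with \<open>\<gamma>\<^sub>i\<close> and squares to \<open>\<eta>\<^sub>j\<^sub>j \<cdot> 1\<close>, so cyclicity of the
  trace gives \<open>\<eta>\<^sub>j\<^sub>j Tr \<gamma>\<^sub>i = Tr (\<gamma>\<^sub>i \<gamma>\<^sub>j \<gamma>\<^sub>j) = - Tr (\<gamma>\<^sub>j \<gamma>\<^sub>i \<gamma>\<^sub>j) = - \<eta>\<^sub>j\<^sub>j Tr \<gamma>\<^sub>i\<close>.\<close>

lemma trace_dirac_matrix:
  assumes d: "dirac_matrices \<eta> \<gamma>" and \<eta>: "lorentz_diagonal \<eta>"
  shows "trace (\<gamma> i) = 0"
proof -
  obtain j :: 4 where "j \<noteq> i"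
    by (metis zero_neq_one)
  with \<eta> have \<eta>_ij: "\<eta> i j = 0" and \<eta>_jj: "\<eta> j j \<noteq> 0"
    unfolding lorentz_diagonal_def by (metis, metis neg_equal_0_iff_equal zero_neq_one)
  have clifford: "\<gamma> i ** \<gamma> j + \<gamma> j ** \<gamma> i = (2 * \<eta> i j) *\<^sub>R mat 1" for i j
    using d unfolding dirac_matrices_def by blast
  have anti: "\<gamma> i ** \<gamma> j = - (\<gamma> j ** \<gamma> i)"
    using clifford[of i j] \<eta>_ij by (simp add: eq_neg_iff_add_eq_0)
  have "2 *\<^sub>R (\<gamma> j ** \<gamma> j) = 2 *\<^sub>R (\<eta> j j *\<^sub>R mat 1)"
    using clifford[of j j] by (simp add: scaleR_2)
  then have sq: "\<gamma> j ** \<gamma> j = \<eta> j j *\<^sub>R mat 1"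
    by (simp only: scaleR_cancel_left) simp
  have "trace (\<gamma> i ** (\<gamma> j ** \<gamma> j)) = trace (- (\<gamma> j ** \<gamma> i) ** \<gamma> j)"
    by (simp add: matrix_mul_assoc anti)
  also have "\<dots> = - trace ((\<gamma> j ** \<gamma> i) ** \<gamma> j)"
    by (simp add: bilinear_lneg[OF bilinear_matrix_mult] linear_neg[OF linear_trace])
  also have "trace ((\<gamma> j ** \<gamma> i) ** \<gamma> j) = trace (\<gamma> i ** (\<gamma> j ** \<gamma> j))"
    by (metis matrix_mul_assoc trace_mul_sym)
  finally have "trace (\<gamma> i ** (\<gamma> j ** \<gamma> j)) = 0"
    by simp
  then show ?thesis
    using \<eta>_jj by (simp add: sq bilinear_rmul[OF bilinear_matrix_mult] linear_cmul[OF linear_trace])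
qed

lemma trace_dirac_slash:
  assumes "dirac_matrices \<eta> \<gamma>" "lorentz_diagonal \<eta>"
  shows "trace (\<Sum>i\<in>UNIV. y i *\<^sub>R \<gamma> i) = 0"
  by (simp add: linear_sum[OF linear_trace] linear_cmul[OF linear_trace] trace_dirac_matrix[OF assms])

lemma trace_dirac_M_dirac_F:
  fixes \<eta> y
  defines "q \<equiv> \<Sum>i\<in>UNIV. \<Sum>j\<in>UNIV. \<eta> i j * y i * y j"
  assumes "dirac_matrices \<eta> \<gamma>" "lorentz_diagonal \<eta>"
  shows "trace (dirac_M \<eta> \<gamma> y ** dirac_F \<gamma> A y) =
         complex_of_real (4 * (q / sqrt \<bar>q\<bar> + (\<Sum>j\<in>UNIV. A j * y j)))"
proof -
  define Y where "Y = (\<Sum>i\<in>UNIV. y i *\<^sub>R \<gamma> i)"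
  define a where "a = (\<Sum>j\<in>UNIV. A j * y j)"
  define s where "s = sqrt \<bar>q\<bar>"
  have Y_square: "Y ** Y = q *\<^sub>R mat 1"
    unfolding Y_def q_def by (rule dirac_slash_square[OF assms(2)])
  have trace_Y: "trace Y = 0"
    unfolding Y_def by (rule trace_dirac_slash[OF assms(2,3)])
  have "dirac_M \<eta> \<gamma> y ** dirac_F \<gamma> A y = (inverse s *\<^sub>R Y - mat 1) ** (Y - a *\<^sub>R mat 1)"
    unfolding dirac_M_def dirac_F_def Y_def a_def s_def q_def by simp
  also have "\<dots> = inverse s *\<^sub>R (Y ** Y) - (inverse s * a) *\<^sub>R Y - (Y - a *\<^sub>R mat 1)"
    by (simp add: bilinear_lsub[OF bilinear_matrix_mult] bilinear_rsub[OF bilinear_matrix_mult]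
        bilinear_lmul[OF bilinear_matrix_mult] bilinear_rmul[OF bilinear_matrix_mult] mult.commute
        algebra_simps)
  finally have "trace (dirac_M \<eta> \<gamma> y ** dirac_F \<gamma> A y) =
      (inverse s * q) *\<^sub>R trace (mat 1 :: complex^4^4) + a *\<^sub>R trace (mat 1 :: complex^4^4)"
    by (simp add: Y_square trace_Y trace_sub linear_cmul[OF linear_trace])
  also have "\<dots> = complex_of_real (4 * (q / s + a))"
    by (simp add: trace_I scaleR_conv_of_real field_simps)
  finally show ?thesis
    unfolding s_def a_def .
qed

theorem proposition2p2:
  fixes \<A> :: "('m::{t2_space, second_countable_topology}, 4) chart set"
    and g :: "'m \<Rightarrow> 'm tangent_vector \<Rightarrow> 'm tangent_vector \<Rightarrow> real"
    and A :: "'m \<Rightarrow> 'm tangent_vector \<Rightarrow> real"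
    and x :: 'm
    and y :: "'m tangent_vector"
    and E :: "4 \<Rightarrow> 'm tangent_vector"
    and \<gamma> :: "4 \<Rightarrow> complex^4^4"
  defines "\<eta> \<equiv> frame_metric g x E"
    and "yc \<equiv> frame_components E y"
    and "Ac \<equiv> (\<lambda>i. A x (E i))"
  assumes "lorentzian_manifold \<A> g"
    and "one_form \<A> A"
    and "y \<in> tangent_space \<A> x"
    and "sqrt \<bar>g x y y\<bar> \<noteq> 0"
    and "orthonormal_frame \<A> g x E"
    and "dirac_matrices \<eta> \<gamma>"
  shows "(g x y y < 0 \<longrightarrow> trace (dirac_M \<eta> \<gamma> yc ** dirac_F \<gamma> Ac yc) =
            complex_of_real (4 * (- sqrt \<bar>g x y y\<bar> + (\<Sum>j\<in>UNIV. Ac j * yc j)))) \<and>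
         (g x y y > 0 \<longrightarrow> trace (dirac_M \<eta> \<gamma> yc ** dirac_F \<gamma> Ac yc) =
            complex_of_real (4 * (sqrt \<bar>g x y y\<bar> + (\<Sum>j\<in>UNIV. Ac j * yc j))))"
proof -
  have g: "lorentzian_metric \<A> g" and E: "frame \<A> x E" and \<eta>: "lorentz_diagonal \<eta>"
    using assms(4,8) unfolding lorentzian_manifold_def orthonormal_frame_def \<eta>_def by auto
  have norm_y: "(\<Sum>i\<in>UNIV. \<Sum>j\<in>UNIV. \<eta> i j * yc i * yc j) = g x y y"
    unfolding \<eta>_def yc_def by (rule lorentzian_metric_frame_components[OF g E assms(6), symmetric])
  have "trace (dirac_M \<eta> \<gamma> yc ** dirac_F \<gamma> Ac yc) =
      complex_of_real (4 * (g x y y / sqrt \<bar>g x y y\<bar> + (\<Sum>j\<in>UNIV. Ac j * yc j)))"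
    using trace_dirac_M_dirac_F[OF assms(9) \<eta>, of yc Ac] by (simp only: norm_y)
  moreover have "g x y y / sqrt \<bar>g x y y\<bar> = - sqrt \<bar>g x y y\<bar>" if "g x y y < 0"
    using that real_div_sqrt[of "- g x y y"] by simp
  moreover have "g x y y / sqrt \<bar>g x y y\<bar> = sqrt \<bar>g x y y\<bar>" if "g x y y > 0"
    using that real_div_sqrt[of "g x y y"] by simp
  ultimately show ?thesis
    by (intro conjI impI) (simp_all only:)
qed

end
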